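(* Let $\{x_t\}$ be generated by the SA2GD algorithm with stochastic subgradients (see context) with integers $n_a,n_b\ge 1$, and suppose the assumptions listed in the context hold: bounded feasible region (diameter bound $\Theta$), Lipschitz continuous functions (constants $\hat L_a,\hat L_b$), unbiased and bounded stochastic subgradients (constants $\tilde L_a,\tilde L_b$), and strong convexity (constants $\hat c_a,\hat c_b$). Let $\lambda_* = n_a/(n_a+n_b)$ and let $x_*$ be the unique minimizer of $S(\cdot,\lambda_* )$ in $\mathcal{X}$. Set $\hat c=\min\{\hat c_a,\hat c_b\}$, $\hat L=\max\{\hat L_a,\hat L_b\}$, $\tilde L=\max\{\tilde L_a,\tilde L_b\}$. If the step sizes are $\alpha_t = \frac{2}{\hat c(t+1)(n_a+n_b)}$, then $$\min_{t=1,\ldots,T}\mathbb{E}[S(x_t,\lambda_* )] - S(x_*,\lambda_* ) \;\le\; \frac{4}{\hat c(T+1)}\left(2\tilde L^2 + \hat L\tilde L + \hat c\,\Theta\tilde L\right).$$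
   Context: Problem: minimize the pair $(f^a(x), f^b(x))$ over $x\in\mathcal{X}$, where $\mathcal{X}\subset\mathbb{R}^n$ is nonempty, compact and convex and the real-valued functions $f^a,f^b$ are possibly non-smooth but subdifferentiable. For $\lambda\in[0,1]$, $S(x,\lambda)=\lambda f^a(x)+(1-\lambda)f^b(x)$. $P_{\mathcal{X}}$ is the orthogonal projection onto $\mathcal{X}$; $\|\cdot\|$ is the Euclidean norm; $\partial f^i(x)$ is the subdifferential of $f^i$ at $x$. SA2GD algorithm: given an initial point $x_0$, step sizes $\alpha_t>0$, and independently drawn random variables $\xi_t^r$ ($0\le r\le n_a+n_b-1$), at each iteration $t=0,1,2,\ldots$ set $y^a_{0,t}=x_t$; for $r=0,\ldots,n_a-1$ set $y^a_{r+1,t}=y^a_{r,t}-\alpha_t g^a(y^a_{r,t},\xi^r_t)$; set $y^b_{0,t}=y^a_{n_a,t}$; for $r=0,\ldots,n_b-1$ set $y^b_{r+1,t}=y^b_{r,t}-\alpha_t g^b(y^b_{r,t},\xi^{n_a+r}_t)$; finally $x_{t+1}=P_{\mathcal{X}}(y^b_{n_b,t})$. Here $g^i(x,\xi)$ is a stochastic subgradient (an unbiased estimator of a subgradient) of $f^i$ at $x$, generated with the random variable $\xi$. Assumptions (for $i\in\{a,b\}$): - Bounded feasible region: $\max_{x,\bar x\in\mathcal{X}}\|x-\bar x\|\le\Theta<\infty$, $\Theta>0$. - Lipschitz functions: $|f^i(\bar x)-f^i(x)|\le\hat L_i\|\bar x-x\|$ for all $(x,\bar x)\in\mathcal{X}\times\mathcal{X}$,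 $\hat L_i>0$. - Stochastic subgradients: for all iterates $t\in\mathbb{N}$, the stochastic subgradients $g^i(x_t,\xi_t)$, generated with random variable $\xi_t$, satisfy $\mathbb{E}_{\xi_t}[g^i(x_t,\xi_t)]\in\partial f^i(x_t)$ and $\mathbb{E}_{\xi_t}[\|g^i(x_t,\xi_t)\|^2]\le\tilde L_i^2$, $\tilde L_i>0$, where $\mathbb{E}_{\xi_t}$ is the conditional expectation with respect to $\xi_t$. - Strong convexity: $f^i(\bar x)\ge f^i(x)+v^\top(\bar x-x)+\frac{\hat c_i}{2}\|\bar x-x\|^2$ for all $(x,\bar x)\in\mathcal{X}\times\mathcal{X}$ and all $v\in\partial f^i(x)$, $\hat c_i>0$.
   Formalization: The unbiasedness and second-moment bounds on the stochastic subgradients are assumed (almost surely) also at the inner iterates y^a_{r,t}, y^b_{r,t} where the algorithm draws them, not only at the iterates x_t; with bounds at x_t alone the claim is false. *)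

theory Defs
  imports "HOL-Probability.Probability"
begin

definition subdifferential :: "('a::real_inner \<Rightarrow> real) \<Rightarrow> 'a \<Rightarrow> 'a set" where
  "subdifferential f x = {v. \<forall>z. f z \<ge> f x + v \<bullet> (z - x)}"

definition strongly_convex_on :: "'a::real_inner set \<Rightarrow> ('a \<Rightarrow> real) \<Rightarrow> real \<Rightarrow> bool" where
  "strongly_convex_on X f c \<longleftrightarrow>
     (\<forall>x\<in>X. \<forall>x'\<in>X. \<forall>v\<in>subdifferential f x.
        f x' \<ge> f x + v \<bullet> (x' - x) + c / 2 * (norm (x' - x))\<^sup>2)"

definition weighted_sum :: "('a \<Rightarrow> real) \<Rightarrow> ('a \<Rightarrow> real) \<Rightarrow> 'a \<Rightarrow> real \<Rightarrow> real" where
  "weighted_sum fa fb x l = l * fa x + (1 - l) * fb x"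

(* D is the law of the random variable xi that generates the estimator g(z, xi), and z is held
   fixed: the integrals are the expectations E_xi taken with respect to xi alone. At a random
   point z independent of xi they are the conditional expectations given z. *)
definition stoch_subgradient_at ::
  "'s measure \<Rightarrow> ('a::euclidean_space \<Rightarrow> real) \<Rightarrow> ('a \<Rightarrow> 's \<Rightarrow> 'a) \<Rightarrow> real \<Rightarrow> 'a \<Rightarrow> bool" where
  "stoch_subgradient_at D f g L z \<longleftrightarrow>
     integrable D (g z) \<and> (\<integral>s. g z s \<partial>D) \<in> subdifferential f z \<and>
     integrable D (\<lambda>s. (norm (g z s))\<^sup>2) \<and> (\<integral>s. (norm (g z s))\<^sup>2 \<partial>D) \<le> L\<^sup>2"

(* One run of the algorithm for a fixed realization xi of the random variables. The argument
   order is (iteration t, inner index r): xi t r, ya t r, yb t r. *)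
definition sa2gd_run ::
  "'a::euclidean_space set \<Rightarrow> nat \<Rightarrow> nat \<Rightarrow> (nat \<Rightarrow> real) \<Rightarrow> ('a \<Rightarrow> 's \<Rightarrow> 'a) \<Rightarrow> ('a \<Rightarrow> 's \<Rightarrow> 'a) \<Rightarrow>
   (nat \<Rightarrow> nat \<Rightarrow> 's) \<Rightarrow> 'a \<Rightarrow> (nat \<Rightarrow> 'a) \<Rightarrow> (nat \<Rightarrow> nat \<Rightarrow> 'a) \<Rightarrow> (nat \<Rightarrow> nat \<Rightarrow> 'a) \<Rightarrow> bool" where
  "sa2gd_run X na nb \<alpha> ga gb \<xi> x0 x ya yb \<longleftrightarrow>
     x 0 = x0 \<and>
     (\<forall>t. ya t 0 = x t \<and>
          (\<forall>r<na. ya t (Suc r) = ya t r - \<alpha> t *\<^sub>R ga (ya t r) (\<xi> t r)) \<and>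
          yb t 0 = ya t na \<and>
          (\<forall>r<nb. yb t (Suc r) = yb t r - \<alpha> t *\<^sub>R gb (yb t r) (\<xi> t (na + r))) \<and>
          x (Suc t) = closest_point X (yb t nb))"

end

theory Submission
  imports Defs
begin

text \<open>
  Write $N = n_a + n_b$, $D_t = E\|x_t - x_*\|^2$ and $A_t = E[S(x_t, \lambda_*)] - S(x_*, \lambda_*)$.
  The inner iterates may leave $X$, where strong convexity is not available, so along the inner steps
  only the subgradient inequality is used: for $v \in \partial f^i(y)$ it gives
  $v^\top (y - x_*) \ge f^i(y) - f^i(x_*) \ge f^i(x_t) - f^i(x_*) - \tilde L \|y - x_t\|$, the last step
  because $f^i$ has a subgradient of norm at most $\tilde L$ at $x_t$. Expanding the square one inner
  step at a time, and using that the $r$-th inner iterate drifts by at most $\alpha_t r \tilde L$ in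
  expectation, yields $D_{t+1} \le D_t - 2 \alpha_t N A_t + \alpha_t^2 N^2 \tilde L^2$.
  Strong convexity enters only through the growth $A_t \ge \hat c D_t / 2$ at the minimizer, which
  feeds back into the recursion as $D_t \le 4 \tilde L^2 / (\hat c^2 t)$. Averaging $A_t$ with weights
  $t$ then gives a bound $6 \tilde L^2 / (\hat c (T + 1))$.
\<close>

section \<open>Real sequences satisfying the descent recursion\<close>

text \<open>Multiplying the descent inequality by \<open>c / 4 * (t + 1)^2\<close> and then by
  \<open>t / (t + 1)\<close> gives \<open>A t\<close> the weight \<open>t\<close> and the difference
  \<open>D t - D (Suc t)\<close> a coefficient proportional to \<open>t * (t + 1)\<close>.
  Consecutive values of \<open>t * (t + 1)\<close> differ by \<open>2 * t\<close>, so partial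
  summation leaves multiples of \<open>t * D t\<close>, which are bounded because growth and descent
  together make \<open>D t\<close> decay like \<open>1 / t\<close>.\<close>

lemma weighted_descent_min:
  fixes A D :: "nat \<Rightarrow> real" and c L :: real
  assumes c: "c > 0" and T: "T \<ge> 1"
    and nonneg: "\<And>t. D t \<ge> 0"
    and init: "D 1 \<le> 4 * L\<^sup>2 / c\<^sup>2"
    and growth: "\<And>t. t \<ge> 1 \<Longrightarrow> c / 2 * D t \<le> A t"
    and descent: "\<And>t. t \<ge> 1 \<Longrightarrow>
      D (Suc t) \<le> D t - 4 / (c * (real t + 1)) * A t + 4 * L\<^sup>2 / (c\<^sup>2 * (real t + 1)\<^sup>2)"
  shows "\<exists>t\<in>{1..T}. A t \<le> 6 * L\<^sup>2 / (c * (real T + 1))"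
proof -
  define K where "K = L\<^sup>2 / c"
  have K: "K \<ge> 0" using c by (simp add: K_def)
  have scaled: "(real t + 1) * A t \<le> c / 4 * (real t + 1)\<^sup>2 * (D t - D (Suc t)) + K"
    if "t \<ge> 1" for t
  proof -
    have "c / 4 * (real t + 1)\<^sup>2 * D (Suc t) \<le> c / 4 * (real t + 1)\<^sup>2 *
       (D t - 4 / (c * (real t + 1)) * A t + 4 * L\<^sup>2 / (c\<^sup>2 * (real t + 1)\<^sup>2))"
      using c by (intro mult_left_mono descent that) auto
    also have "\<dots> = c / 4 * (real t + 1)\<^sup>2 * D t - (real t + 1) * A t + K"
    proof -
      have "c / 4 * u\<^sup>2 * (d - 4 / (c * u) * a + 4 * L\<^sup>2 / (c\<^sup>2 * u\<^sup>2))
          = c / 4 * u\<^sup>2 * d - u * a + K" if "u > 0" for u a d :: real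
        using c that by (simp add: K_def divide_simps) (simp add: algebra_simps power2_eq_square)
      then show ?thesis by simp
    qed
    finally show ?thesis by (simp add: algebra_simps diff_divide_distrib)
  qed
  have weighted: "real t * A t \<le> c / 4 * (real t * (real t + 1)) * (D t - D (Suc t)) + K"
    if "t \<ge> 1" for t
  proof -
    define W where "W = real t + 1"
    have W: "real t \<le> W" by (simp add: W_def)
    have "real t * (W * A t) \<le> real t * (c / 4 * W\<^sup>2 * (D t - D (Suc t)) + K)"
      unfolding W_def by (intro mult_left_mono scaled that) simp
    also have "\<dots> = W * (c / 4 * (real t * W) * (D t - D (Suc t))) + real t * K"
      by (simp add: algebra_simps power2_eq_square)
    \<comment> \<open>Since \<open>K\<close> is nonnegative, enlarging its factor from
      \<open>t\<close> to \<open>W\<close> only weakens the bound, and \<open>W\<close> can then be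
      cancelled throughout.\<close>
    also have "\<dots> \<le> W * (c / 4 * (real t * W) * (D t - D (Suc t)) + K)"
      using mult_right_mono[OF W K] by (simp add: distrib_left)
    finally have "W * (real t * A t) \<le> W * (c / 4 * (real t * W) * (D t - D (Suc t)) + K)"
      by (simp add: mult.left_commute)
    then show ?thesis by (simp add: W_def)
  qed
  have decay: "real t * (c * D t) \<le> 4 * K" if "t \<ge> 1" for t
    using that
  proof (induction t rule: dec_induct)
    case base
    have "c * D 1 \<le> c * (4 * L\<^sup>2 / c\<^sup>2)" using c init by (intro mult_left_mono) auto
    also have "\<dots> = 4 * K" using c by (simp add: K_def field_simps power2_eq_square)
    finally show ?case by simp
  next
    case (step t)
    have "real t * (c / 2 * D t) \<le> real t * A t"
      using growth step.hyps by (intro mult_left_mono) auto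
    with \<open>1 \<le> t\<close> have "real t * (c / 2 * D t) \<le> c / 4 * (real t * (real t + 1)) * (D t - D (Suc t)) + K"
      using weighted[of t] by linarith
    \<comment> \<open>With \<open>E t = t * c * D t\<close> this reads
      \<open>t * E (t + 1) <= (t - 1) * E t + 4 * K\<close>, a recursion that preserves the bound
      \<open>4 * K\<close>.\<close>
    then have "real t * ((real t + 1) * (c * D (Suc t))) \<le> (real t - 1) * (real t * (c * D t)) + 4 * K"
      by (simp add: algebra_simps diff_divide_distrib)
    also have "\<dots> \<le> (real t - 1) * (4 * K) + 4 * K"
      using step by (intro add_right_mono mult_left_mono) auto
    finally have "real t * ((real t + 1) * (c * D (Suc t))) \<le> real t * (4 * K)"
      by (simp add: algebra_simps)
    then show ?case using \<open>1 \<le> t\<close> by (simp add: add.commute)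
  qed
  \<comment> \<open>The last term is kept for the next summand: combined with the
    \<open>D (Suc n)\<close> there it leaves \<open>c / 2 * (n + 1) * D (n + 1)\<close>, at most
    \<open>2 * K\<close> by \<open>decay\<close>. With the \<open>K\<close> of the summand itself
    this makes \<open>3 * K\<close> per index.\<close>
  have total: "(\<Sum>t=1..n. real t * A t) \<le> 3 * K * real n - c / 4 * (real n * (real n + 1)) * D (Suc n)" for n
  proof (induction n)
    case (Suc n)
    have "(\<Sum>t=1..Suc n. real t * A t) \<le> 3 * K * real n - c / 4 * (real n * (real n + 1)) * D (Suc n)
       + (c / 4 * (real (Suc n) * (real (Suc n) + 1)) * (D (Suc n) - D (Suc (Suc n))) + K)"
      using Suc weighted[of "Suc n"] by simp
    also have "\<dots> = 3 * K * real n + K + real (Suc n) * (c * D (Suc n)) / 2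
       - c / 4 * (real (Suc n) * (real (Suc n) + 1)) * D (Suc (Suc n))"
      by (simp add: algebra_simps add_divide_distrib diff_divide_distrib)
    also have "\<dots> \<le> 3 * K * real (Suc n) - c / 4 * (real (Suc n) * (real (Suc n) + 1)) * D (Suc (Suc n))"
      using decay[of "Suc n"] by (simp add: algebra_simps)
    finally show ?case .
  qed simp
  show ?thesis
  proof (rule ccontr)
    assume "\<not> ?thesis"
    then have less: "6 * K / (real T + 1) < A t" if "t \<in> {1..T}" for t
      using that by (auto simp: K_def not_le)
    \<comment> \<open>The weights \<open>1, ..., T\<close> sum to \<open>T * (T + 1) / 2\<close>, so
      if every \<open>A t\<close> exceeded \<open>6 * K / (T + 1)\<close>, the weighted sum would
      exceed the total \<open>3 * K * T\<close>.\<close>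
    have "3 * K * real T = 6 * K / (real T + 1) * (\<Sum>t=1..T. real t)"
    proof -
      have sum: "(\<Sum>t=1..T. real t) = real T * (real T + 1) / 2"
        by (induction T) (auto simp: field_simps)
      show ?thesis unfolding sum by (simp add: field_simps)
    qed
    also have "\<dots> = (\<Sum>t=1..T. real t * (6 * K / (real T + 1)))"
      unfolding sum_distrib_left by (simp add: mult.commute)
    also have "\<dots> < (\<Sum>t=1..T. real t * A t)"
      using T by (intro sum_strict_mono mult_strict_left_mono less) auto
    also have "\<dots> \<le> 3 * K * real T - c / 4 * (real T * (real T + 1)) * D (Suc T)"
      by (rule total)
    also have "\<dots> \<le> 3 * K * real T"
      using c nonneg by simp
    finally show False by simp
  qed
qed

section \<open>Strong convexity and quadratic growth at a constrained minimizer\<close>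

text \<open>Strong convexity is phrased through subgradients, so it is applied at the intermediate
  point towards both ends. In the convex combination the linear terms cancel, and the quadratic ones
  add up by \<open>\<theta>^2 * (1 - \<theta>) + \<theta> * (1 - \<theta>)^2 = \<theta> * (1 -
  \<theta>)\<close>. Where there is no subgradient the definition says nothing, hence the
  nonemptiness assumption.\<close>

lemma strongly_convex_onD_segment:
  fixes x y :: "'a::real_inner"
  assumes "strongly_convex_on X f c" and x: "x \<in> X" and y: "y \<in> X"
    and \<theta>: "0 \<le> \<theta>" "\<theta> \<le> 1"
    and z: "(1 - \<theta>) *\<^sub>R x + \<theta> *\<^sub>R y \<in> X" "subdifferential f ((1 - \<theta>) *\<^sub>R x + \<theta> *\<^sub>R y) \<noteq> {}"
  shows "f ((1 - \<theta>) *\<^sub>R x + \<theta> *\<^sub>R y) + c / 2 * (\<theta> * (1 - \<theta>)) * (norm (y - x))\<^sup>2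
    \<le> (1 - \<theta>) * f x + \<theta> * f y"
proof -
  define m where "m = (1 - \<theta>) *\<^sub>R x + \<theta> *\<^sub>R y"
  obtain v where v: "v \<in> subdifferential f m"
    using z(2) unfolding m_def by blast
  have d: "x - m = (- \<theta>) *\<^sub>R (y - x)" "y - m = (1 - \<theta>) *\<^sub>R (y - x)"
    by (simp_all add: m_def algebra_simps)
  have "f x \<ge> f m + v \<bullet> (x - m) + c / 2 * (norm (x - m))\<^sup>2"
       "f y \<ge> f m + v \<bullet> (y - m) + c / 2 * (norm (y - m))\<^sup>2"
    using assms(1) x y z(1) v unfolding strongly_convex_on_def m_def by blast+
  then have fx: "f x \<ge> f m - \<theta> * (v \<bullet> (y - x)) + c / 2 * (\<theta>\<^sup>2 * (norm (y - x))\<^sup>2)"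
    and fy: "f y \<ge> f m + (1 - \<theta>) * (v \<bullet> (y - x)) + c / 2 * ((1 - \<theta>)\<^sup>2 * (norm (y - x))\<^sup>2)"
    unfolding d by (simp_all add: power_mult_distrib)
  have "f m + c / 2 * (\<theta> * (1 - \<theta>)) * (norm (y - x))\<^sup>2
     = (1 - \<theta>) * (f m - \<theta> * (v \<bullet> (y - x)) + c / 2 * (\<theta>\<^sup>2 * (norm (y - x))\<^sup>2))
     + \<theta> * (f m + (1 - \<theta>) * (v \<bullet> (y - x)) + c / 2 * ((1 - \<theta>)\<^sup>2 * (norm (y - x))\<^sup>2))"
    by (simp add: power2_eq_square field_simps)
  also have "\<dots> \<le> (1 - \<theta>) * f x + \<theta> * f y"
    using fx fy \<theta> by (intro add_mono mult_left_mono) auto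
  finally show ?thesis unfolding m_def .
qed

text \<open>A minimizer over \<open>X\<close> may lie on the boundary and need not have a zero
  subgradient. The growth is therefore read off from segments: minimality bounds the value at
  \<open>m\<close> from below, the segment inequality bounds it from above, and the common factor
  \<open>\<theta>\<close> cancels.\<close>

lemma weighted_sum_growth:
  fixes x y :: "'a::real_inner"
  assumes X: "convex X" "x \<in> X" "y \<in> X"
    and sub: "\<And>z. z \<in> X \<Longrightarrow> subdifferential fa z \<noteq> {}" "\<And>z. z \<in> X \<Longrightarrow> subdifferential fb z \<noteq> {}"
    and sc: "strongly_convex_on X fa ca" "strongly_convex_on X fb cb"
    and c: "c \<le> ca" "c \<le> cb" and l: "0 \<le> l" "l \<le> 1"
    and min: "\<And>z. z \<in> X \<Longrightarrow> weighted_sum fa fb x l \<le> weighted_sum fa fb z l"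
  shows "c / 2 * (norm (y - x))\<^sup>2 \<le> weighted_sum fa fb y l - weighted_sum fa fb x l"
\<comment> \<open>It suffices to prove the bound with an extra factor \<open>s < 1\<close> on the
  left. As \<open>s = 1 - \<theta>\<close>, letting \<open>s\<close> tend to \<open>1\<close> moves
  \<open>m\<close> towards the minimizer \<open>x\<close>.\<close>
proof (rule field_le_mult_one_interval)
  fix s :: real
  assume s: "0 < s" "s < 1"
  define \<theta> where "\<theta> = 1 - s"
  have \<theta>: "0 < \<theta>" "\<theta> < 1" using s by (auto simp: \<theta>_def)
  define m where "m = (1 - \<theta>) *\<^sub>R x + \<theta> *\<^sub>R y"
  define q where "q = \<theta> * (1 - \<theta>) * (norm (y - x))\<^sup>2 / 2"
  have q: "q \<ge> 0" using \<theta> by (auto simp: q_def)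
  have m: "m \<in> X" using X \<theta> unfolding m_def by (intro convexD) auto
  have "fa m + c * q \<le> (1 - \<theta>) * fa x + \<theta> * fa y"
  proof -
    have "fa m + ca * q \<le> (1 - \<theta>) * fa x + \<theta> * fa y"
      using strongly_convex_onD_segment[OF sc(1) X(2,3), of \<theta>] sub(1)[OF m] m \<theta>
      unfolding m_def[symmetric] by (simp add: q_def mult.assoc)
    then show ?thesis using mult_right_mono[OF c(1) q] by linarith
  qed
  moreover have "fb m + c * q \<le> (1 - \<theta>) * fb x + \<theta> * fb y"
  proof -
    have "fb m + cb * q \<le> (1 - \<theta>) * fb x + \<theta> * fb y"
      using strongly_convex_onD_segment[OF sc(2) X(2,3), of \<theta>] sub(2)[OF m] m \<theta>
      unfolding m_def[symmetric] by (simp add: q_def mult.assoc)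
    then show ?thesis using mult_right_mono[OF c(2) q] by linarith
  qed
  ultimately have "l * (fa m + c * q) + (1 - l) * (fb m + c * q)
      \<le> l * ((1 - \<theta>) * fa x + \<theta> * fa y) + (1 - l) * ((1 - \<theta>) * fb x + \<theta> * fb y)"
    using l by (intro add_mono[of "l * _" "l * _" "(1 - l) * _" "(1 - l) * _"] mult_left_mono) auto
  then have "weighted_sum fa fb m l + c * q
      \<le> (1 - \<theta>) * weighted_sum fa fb x l + \<theta> * weighted_sum fa fb y l"
    by (simp add: weighted_sum_def algebra_simps)
  with min[OF m] have "c * q \<le> \<theta> * (weighted_sum fa fb y l - weighted_sum fa fb x l)"
    by (simp add: algebra_simps)
  then have "\<theta> * (s * (c / 2 * (norm (y - x))\<^sup>2)) \<le> \<theta> * (weighted_sum fa fb y l - weighted_sum fa fb x l)"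
    by (simp add: q_def \<theta>_def algebra_simps)
  then show "s * (c / 2 * (norm (y - x))\<^sup>2) \<le> weighted_sum fa fb y l - weighted_sum fa fb x l"
    using \<theta> by simp
qed

section \<open>Second moments and subgradients of bounded norm\<close>

lemma (in prob_space) expectation_le_sqrt_second_moment:
  fixes f :: "'a \<Rightarrow> real"
  assumes f: "f \<in> borel_measurable M" "integrable M (\<lambda>x. (f x)\<^sup>2)"
    and L: "expectation (\<lambda>x. (f x)\<^sup>2) \<le> L\<^sup>2" "0 \<le> L"
  shows "expectation f \<le> L"
proof -
  have "integrable M f" by (rule square_integrable_imp_integrable[OF f])
  from variance_eq[OF this f(2)] variance_positive[of f]
  have "(expectation f)\<^sup>2 \<le> expectation (\<lambda>x. (f x)\<^sup>2)" by linarith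
  with L have "(expectation f)\<^sup>2 \<le> L\<^sup>2" by linarith
  then show ?thesis using L(2) by (rule power2_le_imp_le)
qed

text \<open>The mean of the estimator is the witness. Such a subgradient at \<open>x t\<close>
  bounds the decrease of \<open>f\<close> from \<open>x t\<close> to any point, including points
  outside \<open>X\<close>, where the Lipschitz assumption is silent.\<close>

lemma stoch_subgradient_atD_bounded:
  assumes "prob_space D" and g: "stoch_subgradient_at D f g L z" and L: "0 \<le> L"
  shows "\<exists>u\<in>subdifferential f z. norm u \<le> L"
proof
  interpret D: prob_space D by fact
  show "(\<integral>s. g z s \<partial>D) \<in> subdifferential f z"
    using g by (simp add: stoch_subgradient_at_def)
  have sq: "integrable D (g z)" "integrable D (\<lambda>s. (norm (g z s))\<^sup>2)" "(\<integral>s. (norm (g z s))\<^sup>2 \<partial>D) \<le> L\<^sup>2"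
    using g unfolding stoch_subgradient_at_def by blast+
  have "norm (\<integral>s. g z s \<partial>D) \<le> (\<integral>s. norm (g z s) \<partial>D)"
    by (rule integral_norm_bound)
  also have "\<dots> \<le> L"
    using sq L by (intro D.expectation_le_sqrt_second_moment[OF _ sq(2,3)]) simp_all
  finally show "norm (\<integral>s. g z s \<partial>D) \<le> L" .
qed

section \<open>Independence and integration with one variable frozen\<close>

text \<open>The library's \<^const>\<open>prob_space.indep_var\<close> forces both variables to take values in the same type.\<close>

definition (in prob_space) indep_rv :: "'b measure \<Rightarrow> ('a \<Rightarrow> 'b) \<Rightarrow> 'c measure \<Rightarrow> ('a \<Rightarrow> 'c) \<Rightarrow> bool" where
  "indep_rv S Y T Z \<longleftrightarrow> random_variable S Y \<and> random_variable T Z \<and>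
     distr M S Y \<Otimes>\<^sub>M distr M T Z = distr M (S \<Otimes>\<^sub>M T) (\<lambda>\<omega>. (Y \<omega>, Z \<omega>))"

text \<open>The restrictions to the disjoint index sets \<open>J\<close> and \<open>{i}\<close> are
  independent, and the joint law stays a product when one side is pushed through \<open>h\<close>
  and the other through evaluation at \<open>i\<close>. In the algorithm \<open>J\<close> holds the
  earlier draws and \<open>i\<close> is the current one.\<close>

lemma (in prob_space) indep_rv_of_indep_vars:
  assumes indep: "indep_vars N \<xi> I" and J: "J \<subseteq> I" and i: "i \<in> I" "i \<notin> J"
    and h: "h \<in> PiM J N \<rightarrow>\<^sub>M S" and Y: "\<And>\<omega>. \<omega> \<in> space M \<Longrightarrow> Y \<omega> = h (\<lambda>j\<in>J. \<xi> j \<omega>)"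
  shows "indep_rv S Y (N i) (\<xi> i)"
proof -
  let ?A = "\<lambda>\<omega>. \<lambda>j\<in>J. \<xi> j \<omega>" and ?B = "\<lambda>\<omega>. \<lambda>j\<in>{i}. \<xi> j \<omega>"
  have "indep_var (PiM J N) ?A (PiM {i} N) ?B"
    using J i by (intro indep_var_restrict[OF indep]) auto
  then have A[measurable]: "random_variable (PiM J N) ?A" and B[measurable]: "random_variable (PiM {i} N) ?B"
    and prod: "distr M (PiM J N) ?A \<Otimes>\<^sub>M distr M (PiM {i} N) ?B
      = distr M (PiM J N \<Otimes>\<^sub>M PiM {i} N) (\<lambda>\<omega>. (?A \<omega>, ?B \<omega>))"
    unfolding indep_var_distribution_eq by blast+
  have p[measurable]: "(\<lambda>w. w i) \<in> PiM {i} N \<rightarrow>\<^sub>M N i" by simp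
  note h[measurable]
  have hA: "random_variable S (\<lambda>\<omega>. h (?A \<omega>))" by measurable
  have Z: "random_variable (N i) (\<xi> i)" using measurable_compose[OF B p] by simp
  have Y': "random_variable S Y" using hA Y by (simp cong: measurable_cong)
  interpret B: prob_space "distr M (N i) (\<xi> i)" by (rule prob_space_distr) fact
  have dY: "distr (distr M (PiM J N) ?A) S h = distr M S Y"
    using Y by (subst distr_distr) (auto simp: comp_def intro!: distr_cong)
  have dZ: "distr (distr M (PiM {i} N) ?B) (N i) (\<lambda>w. w i) = distr M (N i) (\<xi> i)"
    by (subst distr_distr) (auto simp: comp_def)
  have "distr M S Y \<Otimes>\<^sub>M distr M (N i) (\<xi> i)
      = distr (distr M (PiM J N) ?A \<Otimes>\<^sub>M distr M (PiM {i} N) ?B) (S \<Otimes>\<^sub>M N i) (\<lambda>(a, w). (h a, w i))"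
    unfolding dY[symmetric] dZ[symmetric]
    by (rule pair_measure_distr) (simp_all add: dZ B.sigma_finite_measure_axioms)
  also have "\<dots> = distr M (S \<Otimes>\<^sub>M N i) (\<lambda>\<omega>. (Y \<omega>, \<xi> i \<omega>))"
    unfolding prod using Y by (subst distr_distr) (auto simp: comp_def intro!: distr_cong)
  finally show ?thesis using Y' Z by (simp add: indep_rv_def)
qed

text \<open>Tonelli for the product of the two laws. With \<open>Y\<close> frozen, the inner
  integral is the conditional expectation given \<open>Y\<close>; the nonnegative form serves where
  integrability is still to be shown.\<close>

lemma (in prob_space) indep_rv_nn_integral:
  assumes indep: "indep_rv S Y T Z" and F: "F \<in> borel_measurable (S \<Otimes>\<^sub>M T)"
  shows "(\<integral>\<^sup>+\<omega>. F (Y \<omega>, Z \<omega>) \<partial>M) = (\<integral>\<^sup>+\<omega>. (\<integral>\<^sup>+s. F (Y \<omega>, s) \<partial>distr M T Z) \<partial>M)"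
proof -
  have Y[measurable]: "random_variable S Y" and Z[measurable]: "random_variable T Z"
    and prod: "distr M S Y \<Otimes>\<^sub>M distr M T Z = distr M (S \<Otimes>\<^sub>M T) (\<lambda>\<omega>. (Y \<omega>, Z \<omega>))"
    using indep unfolding indep_rv_def by auto
  interpret Y: prob_space "distr M S Y" by (rule prob_space_distr) fact
  interpret Z: prob_space "distr M T Z" by (rule prob_space_distr) fact
  have F': "F \<in> borel_measurable (S \<Otimes>\<^sub>M distr M T Z)"
    using F by (simp cong: measurable_cong_sets)
  have F'': "F \<in> borel_measurable (distr M S Y \<Otimes>\<^sub>M distr M T Z)"
    using F by (simp cong: measurable_cong_sets)
  have "(\<integral>\<^sup>+\<omega>. F (Y \<omega>, Z \<omega>) \<partial>M) = integral\<^sup>N (distr M S Y \<Otimes>\<^sub>M distr M T Z) F"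
    unfolding prod using F by (subst nn_integral_distr) auto
  also have "\<dots> = (\<integral>\<^sup>+y. (\<integral>\<^sup>+s. F (y, s) \<partial>distr M T Z) \<partial>distr M S Y)"
    by (rule Z.nn_integral_fst[symmetric, OF F''])
  also have "\<dots> = (\<integral>\<^sup>+\<omega>. (\<integral>\<^sup>+s. F (Y \<omega>, s) \<partial>distr M T Z) \<partial>M)"
    using Z.borel_measurable_nn_integral_fst[OF F'] by (subst nn_integral_distr[OF Y]) simp_all
  finally show ?thesis .
qed

text \<open>Fubini in place of Tonelli: vector-valued integrands, at the price of integrability of
  the composite.\<close>

lemma (in prob_space) indep_rv_integral:
  fixes F :: "_ \<Rightarrow> 'b::{banach, second_countable_topology}"
  assumes indep: "indep_rv S Y T Z" and F: "F \<in> borel_measurable (S \<Otimes>\<^sub>M T)"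
    and int: "integrable M (\<lambda>\<omega>. F (Y \<omega>, Z \<omega>))"
  shows "integrable M (\<lambda>\<omega>. \<integral>s. F (Y \<omega>, s) \<partial>distr M T Z)" (is ?int)
    and "(\<integral>\<omega>. F (Y \<omega>, Z \<omega>) \<partial>M) = (\<integral>\<omega>. (\<integral>s. F (Y \<omega>, s) \<partial>distr M T Z) \<partial>M)" (is ?eq)
proof -
  have Y[measurable]: "random_variable S Y" and Z[measurable]: "random_variable T Z"
    and prod: "distr M S Y \<Otimes>\<^sub>M distr M T Z = distr M (S \<Otimes>\<^sub>M T) (\<lambda>\<omega>. (Y \<omega>, Z \<omega>))"
    using indep unfolding indep_rv_def by auto
  interpret Y: prob_space "distr M S Y" by (rule prob_space_distr) fact
  interpret Z: prob_space "distr M T Z" by (rule prob_space_distr) fact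
  interpret YZ: pair_sigma_finite "distr M S Y" "distr M T Z" ..
  have int': "integrable (distr M S Y \<Otimes>\<^sub>M distr M T Z) F"
    unfolding prod using F int by (subst integrable_distr_eq) auto
  have meas: "(\<lambda>y. \<integral>s. F (y, s) \<partial>distr M T Z) \<in> borel_measurable S"
    using borel_measurable_integrable[OF YZ.integrable_fst'[OF int']] by simp
  show ?int
    using YZ.integrable_fst'[OF int'] integrable_distr_eq[OF Y meas] by simp
  have "(\<integral>\<omega>. F (Y \<omega>, Z \<omega>) \<partial>M) = integral\<^sup>L (distr M S Y \<Otimes>\<^sub>M distr M T Z) F"
    unfolding prod using F by (subst integral_distr) auto
  also have "\<dots> = (\<integral>y. (\<integral>s. F (y, s) \<partial>distr M T Z) \<partial>distr M S Y)"
    by (rule YZ.integral_fst'[symmetric, OF int'])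
  also have "\<dots> = (\<integral>\<omega>. (\<integral>s. F (Y \<omega>, s) \<partial>distr M T Z) \<partial>M)"
    by (rule integral_distr[OF Y meas])
  finally show ?eq .
qed

section \<open>Moments of a stochastic subgradient at a random point\<close>

lemma integrable_inner_of_square_integrable:
  fixes u v :: "'a \<Rightarrow> 'b::euclidean_space"
  assumes [measurable]: "u \<in> borel_measurable M" "v \<in> borel_measurable M"
    and "integrable M (\<lambda>\<omega>. (norm (u \<omega>))\<^sup>2)" "integrable M (\<lambda>\<omega>. (norm (v \<omega>))\<^sup>2)"
  shows "integrable M (\<lambda>\<omega>. u \<omega> \<bullet> v \<omega>)"
proof (rule Bochner_Integration.integrable_bound)
  show "integrable M (\<lambda>\<omega>. (norm (u \<omega>))\<^sup>2 + (norm (v \<omega>))\<^sup>2)"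
    using assms by simp
  have "norm (u \<omega> \<bullet> v \<omega>) \<le> norm ((norm (u \<omega>))\<^sup>2 + (norm (v \<omega>))\<^sup>2)" for \<omega>
  proof -
    have "\<bar>u \<omega> \<bullet> v \<omega>\<bar> \<le> norm (u \<omega>) * norm (v \<omega>)" by (rule Cauchy_Schwarz_ineq2)
    also have "\<dots> \<le> 2 * norm (u \<omega>) * norm (v \<omega>)" by simp
    also have "\<dots> \<le> (norm (u \<omega>))\<^sup>2 + (norm (v \<omega>))\<^sup>2" by (rule sum_squares_bound)
    finally show ?thesis by simp
  qed
  then show "AE \<omega> in M. norm (u \<omega> \<bullet> v \<omega>) \<le> norm ((norm (u \<omega>))\<^sup>2 + (norm (v \<omega>))\<^sup>2)" by simp
qed simp

lemma integrable_norm_diff_square: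
  fixes u v :: "'a \<Rightarrow> 'b::euclidean_space"
  assumes uv: "u \<in> borel_measurable M" "v \<in> borel_measurable M"
    "integrable M (\<lambda>\<omega>. (norm (u \<omega>))\<^sup>2)" "integrable M (\<lambda>\<omega>. (norm (v \<omega>))\<^sup>2)"
  shows "integrable M (\<lambda>\<omega>. (norm (u \<omega> - v \<omega>))\<^sup>2)"
proof -
  have "(norm (u \<omega> - v \<omega>))\<^sup>2 = (norm (u \<omega>))\<^sup>2 + (norm (v \<omega>))\<^sup>2 - 2 * (u \<omega> \<bullet> v \<omega>)" for \<omega>
    by (simp add: power2_norm_eq_inner inner_diff_left inner_diff_right inner_commute)
  then show ?thesis
    using integrable_inner_of_square_integrable[OF uv] uv by simp
qed

text \<open>Integrability is part of the claim, so the computation runs in the extended nonnegative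
  reals: freeze \<open>Y\<close>, bound the inner integral almost surely by \<open>L^2\<close>, and
  read finiteness off the result.\<close>

lemma (in prob_space) stoch_subgradient_second_moment:
  fixes g :: "'b::euclidean_space \<Rightarrow> 's \<Rightarrow> 'b"
  assumes indep: "indep_rv borel Y T Z"
    and g: "(\<lambda>(z, s). g z s) \<in> borel_measurable (borel \<Otimes>\<^sub>M T)"
    and sub: "AE \<omega> in M. stoch_subgradient_at (distr M T Z) f g L (Y \<omega>)"
  shows "integrable M (\<lambda>\<omega>. (norm (g (Y \<omega>) (Z \<omega>)))\<^sup>2)" (is ?int)
    and "expectation (\<lambda>\<omega>. (norm (g (Y \<omega>) (Z \<omega>)))\<^sup>2) \<le> L\<^sup>2" (is ?le)
proof -
  have [measurable]: "random_variable borel Y" "random_variable T Z"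
    using indep unfolding indep_rv_def by auto
  note g[measurable]
  have "(\<integral>\<^sup>+\<omega>. ennreal ((norm (g (Y \<omega>) (Z \<omega>)))\<^sup>2) \<partial>M)
      = (\<integral>\<^sup>+\<omega>. (\<integral>\<^sup>+s. ennreal ((norm (g (Y \<omega>) s))\<^sup>2) \<partial>distr M T Z) \<partial>M)"
    using indep_rv_nn_integral[OF indep, of "\<lambda>(z, s). ennreal ((norm (g z s))\<^sup>2)"] by simp
  also have "\<dots> \<le> (\<integral>\<^sup>+\<omega>. ennreal (L\<^sup>2) \<partial>M)"
  proof (rule nn_integral_mono_AE)
    show "AE \<omega> in M. (\<integral>\<^sup>+s. ennreal ((norm (g (Y \<omega>) s))\<^sup>2) \<partial>distr M T Z) \<le> ennreal (L\<^sup>2)"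
      using sub by eventually_elim (simp add: stoch_subgradient_at_def nn_integral_eq_integral)
  qed
  also have "\<dots> = ennreal (L\<^sup>2)" by (simp add: emeasure_space_1)
  finally have le: "(\<integral>\<^sup>+\<omega>. ennreal ((norm (g (Y \<omega>) (Z \<omega>)))\<^sup>2) \<partial>M) \<le> ennreal (L\<^sup>2)" .
  have meas: "(\<lambda>\<omega>. (norm (g (Y \<omega>) (Z \<omega>)))\<^sup>2) \<in> borel_measurable M" by measurable
  show ?int
    using meas le by (intro integrableI_bounded) (auto simp: less_top[symmetric] top_unique)
  then show ?le
    using le by (subst (asm) nn_integral_eq_integral) auto
qed

text \<open>Once \<open>Y\<close> is frozen, \<open>Y - p\<close> is constant and leaves the inner
  integral. Thus the estimator is replaced by its mean, to which the subgradient inequality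
  applies.\<close>

lemma (in prob_space) stoch_subgradient_inner:
  fixes g :: "'b::euclidean_space \<Rightarrow> 's \<Rightarrow> 'b"
  assumes indep: "indep_rv borel Y T Z"
    and g: "(\<lambda>(z, s). g z s) \<in> borel_measurable (borel \<Otimes>\<^sub>M T)"
    and sub: "AE \<omega> in M. stoch_subgradient_at (distr M T Z) f g L (Y \<omega>)"
    and Y2: "integrable M (\<lambda>\<omega>. (norm (Y \<omega>))\<^sup>2)"
  shows "integrable M (\<lambda>\<omega>. g (Y \<omega>) (Z \<omega>) \<bullet> (Y \<omega> - p))" (is ?int)
    and "integrable M (\<lambda>\<omega>. (\<integral>s. g (Y \<omega>) s \<partial>distr M T Z) \<bullet> (Y \<omega> - p))" (is ?int')
    and "expectation (\<lambda>\<omega>. g (Y \<omega>) (Z \<omega>) \<bullet> (Y \<omega> - p))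
      = expectation (\<lambda>\<omega>. (\<integral>s. g (Y \<omega>) s \<partial>distr M T Z) \<bullet> (Y \<omega> - p))" (is ?eq)
proof -
  have [measurable]: "random_variable borel Y" "random_variable T Z"
    using indep unfolding indep_rv_def by auto
  note g[measurable]
  interpret Z: prob_space "distr M T Z" by (rule prob_space_distr) simp
  show int: ?int
    using stoch_subgradient_second_moment(1)[OF indep g sub] Y2
    by (intro integrable_inner_of_square_integrable integrable_norm_diff_square) auto
  have F: "(\<lambda>(z, s). g z s \<bullet> (z - p)) \<in> borel_measurable (borel \<Otimes>\<^sub>M T)" by measurable
  have eq: "AE \<omega> in M. (\<integral>s. g (Y \<omega>) s \<bullet> (Y \<omega> - p) \<partial>distr M T Z)
      = (\<integral>s. g (Y \<omega>) s \<partial>distr M T Z) \<bullet> (Y \<omega> - p)"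
    using sub by eventually_elim (simp add: stoch_subgradient_at_def)
  have g': "(\<lambda>(z, s). g z s) \<in> borel_measurable (borel \<Otimes>\<^sub>M distr M T Z)"
    using g by (simp cong: measurable_cong_sets)
  \<comment> \<open>This holds at every \<open>z\<close>, also where \<open>g z\<close> is not
    integrable and the integral takes its default value \<open>0\<close>.\<close>
  have [measurable]: "(\<lambda>z. \<integral>s. g z s \<partial>distr M T Z) \<in> borel_measurable borel"
    by (rule Z.borel_measurable_lebesgue_integral[OF g'])
  have i: "integrable M (\<lambda>\<omega>. \<integral>s. g (Y \<omega>) s \<bullet> (Y \<omega> - p) \<partial>distr M T Z)"
    using indep_rv_integral(1)[OF indep F] int by simp
  then show ?int'
    by (rule integrable_cong_AE_imp) (use eq in \<open>auto\<close>)
  have "expectation (\<lambda>\<omega>. g (Y \<omega>) (Z \<omega>) \<bullet> (Y \<omega> - p))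
      = expectation (\<lambda>\<omega>. \<integral>s. g (Y \<omega>) s \<bullet> (Y \<omega> - p) \<partial>distr M T Z)"
    using indep_rv_integral(2)[OF indep F] int by simp
  also have "\<dots> = expectation (\<lambda>\<omega>. (\<integral>s. g (Y \<omega>) s \<partial>distr M T Z) \<bullet> (Y \<omega> - p))"
    using eq borel_measurable_integrable[OF i] by (intro integral_cong_AE) auto
  finally show ?eq .
qed

section \<open>The projected incremental subgradient method with \<open>N\<close> inner
  steps\<close>

text \<open>Both inner loops are merged into one of length \<open>N\<close>, in which the component
  \<open>f r\<close> depends on the position; \<open>z t 0\<close> is the outer iterate.
  \<open>outer\<close> stands beside \<open>stoch\<close> because each component needs a bounded
  subgradient at the outer iterate, whereas \<open>stoch\<close> concerns the iterate at which
  \<open>f r\<close> is sampled.\<close>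

locale projected_incremental_subgradient = prob_space M for M :: "'w measure" +
  fixes X :: "'a::euclidean_space set" and N :: nat
    and f :: "nat \<Rightarrow> 'a \<Rightarrow> real" and g :: "nat \<Rightarrow> 'a \<Rightarrow> 's \<Rightarrow> 'a"
    and \<Xi> :: "'s measure" and \<xi> :: "nat \<Rightarrow> nat \<Rightarrow> 'w \<Rightarrow> 's"
    and \<alpha> :: "nat \<Rightarrow> real" and L :: real and x0 :: 'a and z :: "nat \<Rightarrow> nat \<Rightarrow> 'w \<Rightarrow> 'a"
  assumes X: "X \<noteq> {}" "compact X" "convex X"
    and cont: "\<And>r. r < N \<Longrightarrow> continuous_on X (f r)"
    and indep: "indep_vars (\<lambda>_. \<Xi>) (\<lambda>(t, r). \<xi> t r) (UNIV \<times> {..<N})"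
    and g: "\<And>r. r < N \<Longrightarrow> (\<lambda>(y, s). g r y s) \<in> borel_measurable (borel \<Otimes>\<^sub>M \<Xi>)"
    and init: "\<And>\<omega>. \<omega> \<in> space M \<Longrightarrow> z 0 0 \<omega> = x0"
    and step: "\<And>t r \<omega>. \<omega> \<in> space M \<Longrightarrow> r < N \<Longrightarrow>
      z t (Suc r) \<omega> = z t r \<omega> - \<alpha> t *\<^sub>R g r (z t r \<omega>) (\<xi> t r \<omega>)"
    and proj: "\<And>t \<omega>. \<omega> \<in> space M \<Longrightarrow> z (Suc t) 0 \<omega> = closest_point X (z t N \<omega>)"
    and stoch: "\<And>t r. r < N \<Longrightarrow>
      AE \<omega> in M. stoch_subgradient_at (distr M \<Xi> (\<xi> t r)) (f r) (g r) L (z t r \<omega>)"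
    and outer: "\<And>t r. r < N \<Longrightarrow>
      AE \<omega> in M. \<exists>u\<in>subdifferential (f r) (z t 0 \<omega>). norm u \<le> L"
    and \<alpha>: "\<And>t. \<alpha> t \<ge> 0" and L: "L \<ge> 0"
begin

lemma closed_X: "closed X"
  using X(2) by (rule compact_imp_closed)

lemma continuous_closest_point: "continuous_on UNIV (closest_point X)"
  using X closed_X by (intro continuous_on_closest_point)

lemma outer_mem: "t \<ge> 1 \<Longrightarrow> \<omega> \<in> space M \<Longrightarrow> z t 0 \<omega> \<in> X"
  using proj closest_point_in_set[OF closed_X X(1)] by (cases t) auto

definition past :: "nat \<Rightarrow> nat \<Rightarrow> (nat \<times> nat) set" where
  "past t r = {(t', r'). r' < N \<and> (t' < t \<or> t' = t \<and> r' < r)}"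

lemma past_Suc: "r < N \<Longrightarrow> past t (Suc r) = insert (t, r) (past t r)"
  and past_Suc_0: "past (Suc t) 0 = past t N"
  by (auto simp: past_def)

definition history :: "nat \<Rightarrow> nat \<Rightarrow> 'w \<Rightarrow> nat \<times> nat \<Rightarrow> 's" where
  "history t r \<omega> = (\<lambda>j\<in>past t r. (case j of (t', r') \<Rightarrow> \<xi> t' r') \<omega>)"

lemma history_Suc:
  assumes "r < N"
  shows "restrict (history t (Suc r) \<omega>) (past t r) = history t r \<omega>"
    and "history t (Suc r) \<omega> (t, r) = \<xi> t r \<omega>"
  using assms by (auto simp: history_def past_Suc restrict_def)

lemma history_Suc_0: "history (Suc t) 0 = history t N"
  by (simp add: history_def past_Suc_0 fun_eq_iff)

text \<open>Induction on \<open>r\<close> inside an induction on \<open>t\<close>: an inner step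
  reads one new coordinate, \<open>(t, r)\<close>, and the projection, being continuous, reads none.
  The result takes the place of adaptedness to a filtration.\<close>

lemma iterate_function_of_past:
  assumes "r \<le> N"
  shows "\<exists>h. h \<in> borel_measurable (PiM (past t r) (\<lambda>_. \<Xi>)) \<and>
    (\<forall>\<omega>\<in>space M. z t r \<omega> = h (history t r \<omega>))"
proof -
  let ?P = "\<lambda>t r. \<exists>h. h \<in> borel_measurable (PiM (past t r) (\<lambda>_. \<Xi>)) \<and>
    (\<forall>\<omega>\<in>space M. z t r \<omega> = h (history t r \<omega>))"
  have inner: "?P t r" if "?P t 0" "r \<le> N" for t r
    using that(2)
  proof (induction r)
    case (Suc r)
    then obtain h where h[measurable]: "h \<in> borel_measurable (PiM (past t r) (\<lambda>_. \<Xi>))"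
      and z: "\<And>\<omega>. \<omega> \<in> space M \<Longrightarrow> z t r \<omega> = h (history t r \<omega>)"
      by auto
    have r: "r < N" using Suc.prems by simp
    note g[OF r, measurable]
    let ?h = "\<lambda>w. h (restrict w (past t r))"
    let ?h' = "\<lambda>w. ?h w - \<alpha> t *\<^sub>R g r (?h w) (w (t, r))"
    have sub: "past t r \<subseteq> past t (Suc r)" "(t, r) \<in> past t (Suc r)"
      using r by (auto simp: past_Suc)
    have [measurable]: "(\<lambda>w. restrict w (past t r)) \<in> PiM (past t (Suc r)) (\<lambda>_. \<Xi>) \<rightarrow>\<^sub>M PiM (past t r) (\<lambda>_. \<Xi>)"
      by (rule measurable_restrict_subset[OF sub(1)])
    have [measurable]: "(\<lambda>w. w (t, r)) \<in> PiM (past t (Suc r)) (\<lambda>_. \<Xi>) \<rightarrow>\<^sub>M \<Xi>"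
      by (rule measurable_component_singleton[OF sub(2)])
    have "?h' \<in> borel_measurable (PiM (past t (Suc r)) (\<lambda>_. \<Xi>))"
      by measurable
    moreover have "z t (Suc r) \<omega> = ?h' (history t (Suc r) \<omega>)" if "\<omega> \<in> space M" for \<omega>
      using that by (simp add: step r z history_Suc)
    ultimately show ?case by blast
  qed (use that in simp)
  have "?P t 0"
  proof (induction t)
    case 0
    show ?case by (intro exI[of _ "\<lambda>_. x0"]) (simp add: init)
  next
    case (Suc t)
    then obtain h where h: "h \<in> borel_measurable (PiM (past t N) (\<lambda>_. \<Xi>))"
      and z: "\<And>\<omega>. \<omega> \<in> space M \<Longrightarrow> z t N \<omega> = h (history t N \<omega>)"
      using inner[of t N] by auto
    have "(\<lambda>w. closest_point X (h w)) \<in> borel_measurable (PiM (past t N) (\<lambda>_. \<Xi>))"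
      by (rule borel_measurable_continuous_on[OF continuous_closest_point h])
    then show ?case
      unfolding past_Suc_0 by (intro exI[of _ "\<lambda>w. closest_point X (h w)"]) (simp add: proj z history_Suc_0)
  qed
  then show ?thesis using inner assms by blast
qed

text \<open>The draw used in the step has its index outside \<open>past t r\<close>, and the iterate
  depends on the draws in \<open>past t r\<close> only.\<close>

lemma iterate_indep:
  assumes r: "r < N"
  shows "indep_rv borel (z t r) \<Xi> (\<xi> t r)"
proof -
  obtain h where h: "h \<in> borel_measurable (PiM (past t r) (\<lambda>_. \<Xi>))"
    and z: "\<And>\<omega>. \<omega> \<in> space M \<Longrightarrow> z t r \<omega> = h (history t r \<omega>)"
    using iterate_function_of_past[of r t] r by auto
  have "past t r \<subseteq> UNIV \<times> {..<N}" "(t, r) \<in> UNIV \<times> {..<N}" "(t, r) \<notin> past t r"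
    using r by (auto simp: past_def)
  from indep_rv_of_indep_vars[OF indep this h z[unfolded history_def]] show ?thesis
    by simp
qed

lemma iterate_measurable: "r \<le> N \<Longrightarrow> random_variable borel (z t r)"
proof -
  assume "r \<le> N"
  then obtain h where h[measurable]: "h \<in> borel_measurable (PiM (past t r) (\<lambda>_. \<Xi>))"
    and z: "\<And>\<omega>. \<omega> \<in> space M \<Longrightarrow> z t r \<omega> = h (history t r \<omega>)"
    using iterate_function_of_past[of r t] by auto
  have "random_variable \<Xi> ((\<lambda>(t, r). \<xi> t r) j)" if "j \<in> past t r" for j
    using indep that unfolding indep_vars_def past_def by auto
  then have "history t r \<in> M \<rightarrow>\<^sub>M PiM (past t r) (\<lambda>_. \<Xi>)"
    unfolding history_def by (rule measurable_restrict)
  then have "(\<lambda>\<omega>. h (history t r \<omega>)) \<in> borel_measurable M"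
    by measurable
  then show ?thesis using z by (simp cong: measurable_cong)
qed

text \<open>For \<open>t >= 1\<close> the outer iterate is a projection, so it stays in the compact
  set \<open>X\<close>, on which \<open>h\<close> is bounded; the start \<open>x0\<close> may lie
  outside.\<close>

lemma integrable_outer:
  assumes t: "t \<ge> 1" and h: "continuous_on X (h :: 'a \<Rightarrow> real)"
  shows "integrable M (\<lambda>\<omega>. h (z t 0 \<omega>))"
proof -
  obtain B where B: "\<And>x. x \<in> X \<Longrightarrow> \<bar>h x\<bar> \<le> B"
    using compact_imp_bounded[OF compact_continuous_image[OF h X(2)]]
    by (auto simp: bounded_iff)
  \<comment> \<open>\<open>h\<close> is continuous on \<open>X\<close> only. Composed with the
    projection it is continuous everywhere and has the same value at the iterate, which yields
    measurability.\<close>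
  have "continuous_on UNIV (\<lambda>y. h (closest_point X y))"
    using closest_point_in_set[OF closed_X X(1)]
    by (intro continuous_on_compose2[OF h continuous_closest_point]) auto
  then have "(\<lambda>\<omega>. h (closest_point X (z t 0 \<omega>))) \<in> borel_measurable M"
    using iterate_measurable[of 0 t] by (intro borel_measurable_continuous_on[of "\<lambda>y. h (closest_point X y)"]) auto
  then have "(\<lambda>\<omega>. h (z t 0 \<omega>)) \<in> borel_measurable M"
    using closest_point_self[OF outer_mem[OF t]] by (simp cong: measurable_cong)
  then show ?thesis
    using B outer_mem[OF t] by (intro integrable_const_bound[of _ B]) auto
qed

text \<open>Inner iterates may leave \<open>X\<close>, so boundedness is available at
  \<open>r = 0\<close> only; from there the second moment of each step keeps the square
  integrable.\<close>

lemma integrable_iterate_square: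
  assumes "t \<ge> 1" "r \<le> N"
  shows "integrable M (\<lambda>\<omega>. (norm (z t r \<omega>))\<^sup>2)"
  using assms(2)
proof (induction r)
  case 0
  show ?case by (rule integrable_outer[OF assms(1)]) (intro continuous_intros)
next
  case (Suc r)
  have r: "r < N" using Suc.prems by simp
  note G = iterate_indep[OF r, of t] g[OF r] stoch[OF r, of t]
  have meas: "(\<lambda>\<omega>. g r (z t r \<omega>) (\<xi> t r \<omega>)) \<in> borel_measurable M"
    using measurable_compose[OF measurable_Pair g[OF r], of "z t r" M "\<xi> t r"] G(1)
    by (simp add: indep_rv_def)
  have "integrable M (\<lambda>\<omega>. (norm (z t r \<omega> - \<alpha> t *\<^sub>R g r (z t r \<omega>) (\<xi> t r \<omega>)))\<^sup>2)"
    using Suc r iterate_measurable[of r t] meas stoch_subgradient_second_moment(1)[OF G]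
    by (intro integrable_norm_diff_square) (auto simp: power_mult_distrib)
  then show ?case
    by (rule Bochner_Integration.integrable_cong[THEN iffD1, rotated 2]) (simp_all add: step r)
qed

text \<open>A first moment suffices, since the drift enters the estimate of a single step
  linearly.\<close>

lemma expected_inner_drift:
  assumes t: "t \<ge> 1" and "r \<le> N"
  shows "integrable M (\<lambda>\<omega>. norm (z t r \<omega> - z t 0 \<omega>)) \<and>
    expectation (\<lambda>\<omega>. norm (z t r \<omega> - z t 0 \<omega>)) \<le> \<alpha> t * real r * L"
  using assms(2)
proof (induction r)
  case (Suc r)
  have r: "r < N" using Suc.prems by simp
  let ?G = "\<lambda>\<omega>. g r (z t r \<omega>) (\<xi> t r \<omega>)"
  note G = iterate_indep[OF r, of t] g[OF r] stoch[OF r, of t]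
  have G_meas[measurable]: "?G \<in> borel_measurable M"
    using measurable_compose[OF measurable_Pair g[OF r], of "z t r" M "\<xi> t r"] G(1)
    by (simp add: indep_rv_def)
  have [measurable]: "random_variable borel (z t (Suc r))" "random_variable borel (z t 0)"
    using Suc.prems by (auto intro: iterate_measurable)
  have G_int: "integrable M (\<lambda>\<omega>. norm (?G \<omega>))"
    by (rule square_integrable_imp_integrable[OF _ stoch_subgradient_second_moment(1)[OF G]]) simp
  have G_le: "expectation (\<lambda>\<omega>. norm (?G \<omega>)) \<le> L"
    by (rule expectation_le_sqrt_second_moment[OF _ stoch_subgradient_second_moment[OF G] L]) simp
  have IH: "integrable M (\<lambda>\<omega>. norm (z t r \<omega> - z t 0 \<omega>))"
      "expectation (\<lambda>\<omega>. norm (z t r \<omega> - z t 0 \<omega>)) \<le> \<alpha> t * real r * L"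
    using Suc.IH r by auto
  have bound: "norm (z t (Suc r) \<omega> - z t 0 \<omega>) \<le> norm (z t r \<omega> - z t 0 \<omega>) + \<alpha> t * norm (?G \<omega>)"
    if "\<omega> \<in> space M" for \<omega>
  proof -
    have "z t (Suc r) \<omega> - z t 0 \<omega> = (z t r \<omega> - z t 0 \<omega>) - \<alpha> t *\<^sub>R ?G \<omega>"
      by (simp add: step that r)
    also have "norm \<dots> \<le> norm (z t r \<omega> - z t 0 \<omega>) + norm (\<alpha> t *\<^sub>R ?G \<omega>)"
      by (rule norm_triangle_ineq4)
    finally show ?thesis using \<alpha>[of t] by simp
  qed
  have dom: "integrable M (\<lambda>\<omega>. norm (z t r \<omega> - z t 0 \<omega>) + \<alpha> t * norm (?G \<omega>))"
    using IH(1) G_int by simp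
  have int: "integrable M (\<lambda>\<omega>. norm (z t (Suc r) \<omega> - z t 0 \<omega>))"
  proof (rule Bochner_Integration.integrable_bound[OF dom])
    show "AE \<omega> in M. norm (norm (z t (Suc r) \<omega> - z t 0 \<omega>))
        \<le> norm (norm (z t r \<omega> - z t 0 \<omega>) + \<alpha> t * norm (?G \<omega>))"
      using bound \<alpha>[of t] by (intro AE_I2) simp
  qed simp
  have "expectation (\<lambda>\<omega>. norm (z t (Suc r) \<omega> - z t 0 \<omega>))
      \<le> expectation (\<lambda>\<omega>. norm (z t r \<omega> - z t 0 \<omega>) + \<alpha> t * norm (?G \<omega>))"
    by (rule integral_mono[OF int dom bound])
  also have "\<dots> \<le> \<alpha> t * real r * L + \<alpha> t * L"
    using IH G_int mult_left_mono[OF G_le \<alpha>[of t]] by simp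
  finally show ?case using int by (simp add: algebra_simps)
qed simp

text \<open>In \<open>2 * r + 1\<close> the \<open>1\<close> comes from the second moment of the
  step, and \<open>2 * r\<close> is the price of evaluating \<open>f r\<close> at the outer iterate:
  the factor \<open>2 * \<alpha> t\<close> of the cross term times \<open>L\<close> times the drift
  bound \<open>\<alpha> t * r * L\<close>.\<close>

lemma expected_inner_step:
  assumes t: "t \<ge> 1" and r: "r < N" and p: "p \<in> X"
  shows "expectation (\<lambda>\<omega>. (norm (z t (Suc r) \<omega> - p))\<^sup>2)
    \<le> expectation (\<lambda>\<omega>. (norm (z t r \<omega> - p))\<^sup>2)
       - 2 * \<alpha> t * (expectation (\<lambda>\<omega>. f r (z t 0 \<omega>)) - f r p)
       + (\<alpha> t)\<^sup>2 * L\<^sup>2 * (2 * real r + 1)"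
proof -
  let ?G = "\<lambda>\<omega>. g r (z t r \<omega>) (\<xi> t r \<omega>)"
  let ?v = "\<lambda>\<omega>. \<integral>s. g r (z t r \<omega>) s \<partial>distr M \<Xi> (\<xi> t r)"
  note G = iterate_indep[OF r, of t] g[OF r] stoch[OF r, of t]
  have z2: "integrable M (\<lambda>\<omega>. (norm (z t r \<omega>))\<^sup>2)"
    using t r by (intro integrable_iterate_square) auto
  have [measurable]: "random_variable borel (z t r)"
    using r by (intro iterate_measurable) auto
  have d2: "integrable M (\<lambda>\<omega>. (norm (z t r \<omega> - p))\<^sup>2)"
    using z2 by (intro integrable_norm_diff_square) auto
  note inner = stoch_subgradient_inner[OF G z2, of p]
  note moment = stoch_subgradient_second_moment[OF G]
  have drift: "integrable M (\<lambda>\<omega>. norm (z t r \<omega> - z t 0 \<omega>))"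
      "expectation (\<lambda>\<omega>. norm (z t r \<omega> - z t 0 \<omega>)) \<le> \<alpha> t * real r * L"
    using expected_inner_drift[OF t, of r] r by auto
  have f_int: "integrable M (\<lambda>\<omega>. f r (z t 0 \<omega>))"
    by (rule integrable_outer[OF t cont[OF r]])
  have "expectation (\<lambda>\<omega>. f r (z t 0 \<omega>)) - f r p - L * (\<alpha> t * real r * L)
      \<le> expectation (\<lambda>\<omega>. f r (z t 0 \<omega>)) - f r p - L * expectation (\<lambda>\<omega>. norm (z t r \<omega> - z t 0 \<omega>))"
    using mult_left_mono[OF drift(2) L] by simp
  also have "\<dots> = expectation (\<lambda>\<omega>. f r (z t 0 \<omega>) - f r p - L * norm (z t r \<omega> - z t 0 \<omega>))"
    using f_int drift(1) by (simp add: prob_space)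
  \<comment> \<open>Two subgradient inequalities are chained: the mean \<open>?v\<close> at the
    inner iterate towards \<open>p\<close>, and a subgradient of norm at most \<open>L\<close> at
    the outer iterate towards the inner one. Both hold on the whole space.\<close>
  also have "\<dots> \<le> expectation (\<lambda>\<omega>. ?v \<omega> \<bullet> (z t r \<omega> - p))"
  proof (rule integral_mono_AE)
    show "AE \<omega> in M. f r (z t 0 \<omega>) - f r p - L * norm (z t r \<omega> - z t 0 \<omega>) \<le> ?v \<omega> \<bullet> (z t r \<omega> - p)"
      using stoch[OF r, of t] outer[OF r, of t]
    proof eventually_elim
      case (elim \<omega>)
      then obtain u where u: "u \<in> subdifferential (f r) (z t 0 \<omega>)" "norm u \<le> L" by blast
      have "f r p \<ge> f r (z t r \<omega>) + ?v \<omega> \<bullet> (p - z t r \<omega>)"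
        using elim(1) unfolding stoch_subgradient_at_def subdifferential_def by blast
      moreover have "f r (z t r \<omega>) \<ge> f r (z t 0 \<omega>) + u \<bullet> (z t r \<omega> - z t 0 \<omega>)"
        using u(1) unfolding subdifferential_def by blast
      moreover have "\<bar>u \<bullet> (z t r \<omega> - z t 0 \<omega>)\<bar> \<le> L * norm (z t r \<omega> - z t 0 \<omega>)"
        using Cauchy_Schwarz_ineq2[of u "z t r \<omega> - z t 0 \<omega>"] mult_right_mono[OF u(2) norm_ge_zero]
        by (rule order_trans)
      ultimately show ?case by (simp add: inner_diff_right)
    qed
  qed (use f_int drift(1) inner(2) in simp_all)
  also have "\<dots> = expectation (\<lambda>\<omega>. ?G \<omega> \<bullet> (z t r \<omega> - p))"
    by (rule inner(3)[symmetric])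
  finally have lower: "expectation (\<lambda>\<omega>. f r (z t 0 \<omega>)) - f r p - L * (\<alpha> t * real r * L)
      \<le> expectation (\<lambda>\<omega>. ?G \<omega> \<bullet> (z t r \<omega> - p))" .
  have expand: "(norm (z t (Suc r) \<omega> - p))\<^sup>2
      = (norm (z t r \<omega> - p))\<^sup>2 - 2 * \<alpha> t * (?G \<omega> \<bullet> (z t r \<omega> - p)) + (\<alpha> t)\<^sup>2 * (norm (?G \<omega>))\<^sup>2"
    if "\<omega> \<in> space M" for \<omega>
  proof -
    have "(norm (d - a *\<^sub>R G))\<^sup>2 = (norm d)\<^sup>2 - 2 * a * (G \<bullet> d) + a\<^sup>2 * (norm G)\<^sup>2" for d G :: 'a and a
      unfolding power2_norm_eq_inner
      by (simp add: inner_diff_left inner_diff_right inner_commute power2_eq_square)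
    from this[of "z t r \<omega> - p" "\<alpha> t" "?G \<omega>"] show ?thesis
      by (simp add: step that r algebra_simps)
  qed
  have "expectation (\<lambda>\<omega>. (norm (z t (Suc r) \<omega> - p))\<^sup>2)
      = expectation (\<lambda>\<omega>. (norm (z t r \<omega> - p))\<^sup>2 - 2 * \<alpha> t * (?G \<omega> \<bullet> (z t r \<omega> - p))
          + (\<alpha> t)\<^sup>2 * (norm (?G \<omega>))\<^sup>2)"
    by (rule Bochner_Integration.integral_cong) (simp_all add: expand)
  also have "\<dots> = expectation (\<lambda>\<omega>. (norm (z t r \<omega> - p))\<^sup>2)
      - 2 * \<alpha> t * expectation (\<lambda>\<omega>. ?G \<omega> \<bullet> (z t r \<omega> - p))
      + (\<alpha> t)\<^sup>2 * expectation (\<lambda>\<omega>. (norm (?G \<omega>))\<^sup>2)"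
    using d2 inner(1) moment(1) by simp
  also have "\<dots> \<le> expectation (\<lambda>\<omega>. (norm (z t r \<omega> - p))\<^sup>2)
      - 2 * \<alpha> t * (expectation (\<lambda>\<omega>. f r (z t 0 \<omega>)) - f r p - L * (\<alpha> t * real r * L))
      + (\<alpha> t)\<^sup>2 * L\<^sup>2"
    using \<alpha>[of t] lower moment(2) by (intro add_mono diff_mono mult_left_mono order_refl) auto
  finally show ?thesis by (simp add: algebra_simps power2_eq_square)
qed

text \<open>The odd numbers \<open>2 * r + 1\<close> with \<open>r < N\<close> sum to
  \<open>N^2\<close>, and the projection is nonexpansive and fixes \<open>p\<close>.\<close>

lemma expected_descent:
  assumes t: "t \<ge> 1" and p: "p \<in> X"
  shows "expectation (\<lambda>\<omega>. (norm (z (Suc t) 0 \<omega> - p))\<^sup>2)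
    \<le> expectation (\<lambda>\<omega>. (norm (z t 0 \<omega> - p))\<^sup>2)
       - 2 * \<alpha> t * (\<Sum>r<N. expectation (\<lambda>\<omega>. f r (z t 0 \<omega>)) - f r p)
       + (\<alpha> t)\<^sup>2 * L\<^sup>2 * (real N)\<^sup>2"
proof -
  have inner: "expectation (\<lambda>\<omega>. (norm (z t n \<omega> - p))\<^sup>2)
      \<le> expectation (\<lambda>\<omega>. (norm (z t 0 \<omega> - p))\<^sup>2)
       - 2 * \<alpha> t * (\<Sum>r<n. expectation (\<lambda>\<omega>. f r (z t 0 \<omega>)) - f r p)
       + (\<alpha> t)\<^sup>2 * L\<^sup>2 * (real n)\<^sup>2" if "n \<le> N" for n
    using that
  proof (induction n)
    case (Suc n)
    then show ?case
      using expected_inner_step[OF t, of n p] p by (simp add: algebra_simps power2_eq_square)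
  qed simp
  have *: "integrable M (\<lambda>\<omega>. (norm (y \<omega> - p))\<^sup>2)"
    if "random_variable borel y" "integrable M (\<lambda>\<omega>. (norm (y \<omega>))\<^sup>2)" for y
    using that by (intro integrable_norm_diff_square) auto
  have "expectation (\<lambda>\<omega>. (norm (z (Suc t) 0 \<omega> - p))\<^sup>2) \<le> expectation (\<lambda>\<omega>. (norm (z t N \<omega> - p))\<^sup>2)"
  proof (rule integral_mono)
    fix \<omega> assume \<omega>: "\<omega> \<in> space M"
    have "norm (z (Suc t) 0 \<omega> - p) \<le> norm (z t N \<omega> - p)"
      using closest_point_lipschitz[OF X(3) closed_X X(1), of "z t N \<omega>" p] closest_point_self[OF p]
      by (simp add: proj \<omega> dist_norm)
    then show "(norm (z (Suc t) 0 \<omega> - p))\<^sup>2 \<le> (norm (z t N \<omega> - p))\<^sup>2"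
      by (simp add: power_mono)
  qed (use t in \<open>auto intro!: * iterate_measurable integrable_iterate_square\<close>)
  also note inner[OF order_refl]
  finally show ?thesis .
qed

end

section \<open>The two-loop algorithm as an instance, and the final rate\<close>

lemma stoch_subgradient_at_mono:
  "stoch_subgradient_at D f g K y \<Longrightarrow> 0 \<le> K \<Longrightarrow> K \<le> L \<Longrightarrow> stoch_subgradient_at D f g L y"
  unfolding stoch_subgradient_at_def by (meson order_trans power_mono)

lemma sum_two_blocks:
  fixes a b :: real
  shows "(\<Sum>r<m + n. if r < m then a else b) = real m * a + real n * b"
  by (induction n) (auto simp: algebra_simps)

theorem theorem3p2:
  fixes X :: "(real ^ 'n) set"
    and fa fb :: "real ^ 'n \<Rightarrow> real"
    and M :: "'w measure" and \<Xi> :: "'s measure"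
    and ga gb :: "real ^ 'n \<Rightarrow> 's \<Rightarrow> real ^ 'n"
    and \<xi> :: "nat \<Rightarrow> nat \<Rightarrow> 'w \<Rightarrow> 's"
    and x0 x_star :: "real ^ 'n"
    and x :: "nat \<Rightarrow> 'w \<Rightarrow> real ^ 'n"
    and ya yb :: "nat \<Rightarrow> nat \<Rightarrow> 'w \<Rightarrow> real ^ 'n"
    and na nb T :: nat
    and \<alpha> :: "nat \<Rightarrow> real"
    and \<Theta> La Lb La' Lb' ca cb c L L' lam :: real
  assumes X: "X \<noteq> {}" "compact X" "convex X"
    and subdifferentiable: "\<And>z. z \<in> X \<Longrightarrow> subdifferential fa z \<noteq> {}"
                           "\<And>z. z \<in> X \<Longrightarrow> subdifferential fb z \<noteq> {}"
    and inner_steps: "na \<ge> 1" "nb \<ge> 1"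
    and prob: "prob_space M"
    and indep: "prob_space.indep_vars M (\<lambda>_. \<Xi>) (\<lambda>(t, r). \<xi> t r) (UNIV \<times> {..<na + nb})"
    and meas: "(\<lambda>(z, s). ga z s) \<in> borel_measurable (borel \<Otimes>\<^sub>M \<Xi>)"
              "(\<lambda>(z, s). gb z s) \<in> borel_measurable (borel \<Otimes>\<^sub>M \<Xi>)"
    and run: "\<And>\<omega>. \<omega> \<in> space M \<Longrightarrow>
        sa2gd_run X na nb \<alpha> ga gb (\<lambda>t r. \<xi> t r \<omega>) x0
          (\<lambda>t. x t \<omega>) (\<lambda>t r. ya t r \<omega>) (\<lambda>t r. yb t r \<omega>)"
    and bounded_region: "\<Theta> > 0" "\<And>z z'. z \<in> X \<Longrightarrow> z' \<in> X \<Longrightarrow> norm (z - z') \<le> \<Theta>"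
    and lipschitz: "La > 0" "La-lipschitz_on X fa" "Lb > 0" "Lb-lipschitz_on X fb"
    and stoch_pos: "La' > 0" "Lb' > 0"
    and stoch_outer: "\<And>t r. r < na + nb \<Longrightarrow>
        AE \<omega> in M. stoch_subgradient_at (distr M \<Xi> (\<xi> t r)) fa ga La' (x t \<omega>) \<and>
                   stoch_subgradient_at (distr M \<Xi> (\<xi> t r)) fb gb Lb' (x t \<omega>)"
    and stoch_inner_a: "\<And>t r. r < na \<Longrightarrow>
        AE \<omega> in M. stoch_subgradient_at (distr M \<Xi> (\<xi> t r)) fa ga La' (ya t r \<omega>)"
    and stoch_inner_b: "\<And>t r. r < nb \<Longrightarrow>
        AE \<omega> in M. stoch_subgradient_at (distr M \<Xi> (\<xi> t (na + r))) fb gb Lb' (yb t r \<omega>)"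
    and strong_convexity: "ca > 0" "strongly_convex_on X fa ca" "cb > 0" "strongly_convex_on X fb cb"
    and constants: "c = min ca cb" "L = max La Lb" "L' = max La' Lb'"
    and lam: "lam = real na / real (na + nb)"
    and x_star: "is_arg_min (\<lambda>z. weighted_sum fa fb z lam) (\<lambda>z. z \<in> X) x_star"
    and step_size: "\<And>t. \<alpha> t = 2 / (c * (real t + 1) * (real na + real nb))"
    and T: "T \<ge> 1"
  shows "Min ((\<lambda>t. prob_space.expectation M (\<lambda>\<omega>. weighted_sum fa fb (x t \<omega>) lam)) ` {1..T})
           - weighted_sum fa fb x_star lam
         \<le> 4 / (c * (real T + 1)) * (2 * L'\<^sup>2 + L * L' + c * \<Theta> * L')"
proof -
  interpret prob_space M by (rule prob)
  define N where "N = na + nb"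
  define f where "f r = (if r < na then fa else fb)" for r
  define g where "g r = (if r < na then ga else gb)" for r
  \<comment> \<open>The loops meet at \<open>r = na\<close>, where \<open>yb t 0 = ya t na\<close>,
    so either description is valid there.\<close>
  define z where "z t r \<omega> = (if r \<le> na then ya t r \<omega> else yb t (r - na) \<omega>)" for t r \<omega>
  let ?S = "\<lambda>w. weighted_sum fa fb w lam"
  have c: "0 < c" "c \<le> ca" "c \<le> cb" using strong_convexity constants by auto
  have L': "0 < L'" "La' \<le> L'" "Lb' \<le> L'" using stoch_pos constants by auto
  have L_pos: "0 < L" using lipschitz constants by auto
  have l: "0 \<le> lam" "lam \<le> 1" using lam inner_steps by auto
  \<comment> \<open>With this weight, \<open>na\<close> copies of \<open>fa\<close> and
    \<open>nb\<close> copies of \<open>fb\<close> add up to \<open>N\<close> times the weighted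
    sum.\<close>
  have N: "real N > 0" "real na = real N * lam" "real nb = real N * (1 - lam)"
    using inner_steps lam by (auto simp: N_def field_simps)
  have lo: "z t r = ya t r" if "r \<le> na" for t r using that by (simp add: z_def fun_eq_iff)
  have hi: "z t r \<omega> = yb t (r - na) \<omega>" if "na \<le> r" "\<omega> \<in> space M" for t r \<omega>
    using that run[OF that(2)] by (cases "r = na") (auto simp: z_def sa2gd_run_def)
  have stochz: "AE \<omega> in M. stoch_subgradient_at (distr M \<Xi> (\<xi> t r)) (f r) (g r) L' (z t r \<omega>)"
    if r: "r < N" for t r
  proof (cases "r < na")
    case True
    have "AE \<omega> in M. stoch_subgradient_at (distr M \<Xi> (\<xi> t r)) fa ga L' (ya t r \<omega>)"
      using stoch_inner_a[OF True, of t] stoch_pos L' by (auto elim!: eventually_mono stoch_subgradient_at_mono)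
    then show ?thesis using True by (simp add: f_def g_def lo)
  next
    case False
    then have "r - na < nb" "na + (r - na) = r" using r by (auto simp: N_def)
    with stoch_inner_b[of "r - na" t]
    have "AE \<omega> in M. stoch_subgradient_at (distr M \<Xi> (\<xi> t r)) fb gb L' (yb t (r - na) \<omega>)"
      using stoch_pos L' by (auto elim!: eventually_mono stoch_subgradient_at_mono)
    then show ?thesis
      using AE_space by eventually_elim (use False in \<open>simp add: f_def g_def hi\<close>)
  qed
  have xi: "random_variable \<Xi> (\<xi> t r)" if "r < N" for t r
    using indep that unfolding indep_vars_def N_def by auto
  \<comment> \<open>\<open>stoch_outer\<close> covers both objectives at \<open>x t\<close>, so
    \<open>fb\<close> too has a bounded subgradient there although it is sampled only in the second
    loop.\<close>
  have outerz: "AE \<omega> in M. \<exists>u\<in>subdifferential (f r) (z t 0 \<omega>). norm u \<le> L'" if r: "r < N" for t r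
    using stoch_outer[OF r[unfolded N_def], of t] AE_space
  proof eventually_elim
    case (elim \<omega>)
    have "x t \<omega> = z t 0 \<omega>" using run[OF elim(2)] by (simp add: lo sa2gd_run_def)
    with elim have "stoch_subgradient_at (distr M \<Xi> (\<xi> t r)) (f r) (g r) L' (z t 0 \<omega>)"
      using stoch_pos L' by (auto simp: f_def g_def intro: stoch_subgradient_at_mono)
    then show ?case
      by (rule stoch_subgradient_atD_bounded[OF prob_space_distr[OF xi[OF r]] _ less_imp_le[OF L'(1)]])
  qed
  interpret projected_incremental_subgradient M X N f g \<Xi> \<xi> \<alpha> L' x0 z
  proof unfold_locales
    show "continuous_on X (f r)" for r
      using lipschitz by (auto simp: f_def intro: lipschitz_on_continuous_on)
    show "(\<lambda>(y, s). g r y s) \<in> borel_measurable (borel \<Otimes>\<^sub>M \<Xi>)" for r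
      using meas by (simp add: g_def)
    show "z 0 0 \<omega> = x0" if "\<omega> \<in> space M" for \<omega>
      using run[OF that] by (simp add: lo sa2gd_run_def)
    show "z t (Suc r) \<omega> = z t r \<omega> - \<alpha> t *\<^sub>R g r (z t r \<omega>) (\<xi> t r \<omega>)"
      if "\<omega> \<in> space M" "r < N" for t r \<omega>
    proof (cases "r < na")
      case True
      then show ?thesis using run[OF that(1)] by (simp add: lo g_def sa2gd_run_def)
    next
      case False
      then have "r - na < nb" "na + (r - na) = r" "Suc r - na = Suc (r - na)"
        using that(2) by (auto simp: N_def)
      moreover have "yb t (Suc k) \<omega> = yb t k \<omega> - \<alpha> t *\<^sub>R gb (yb t k \<omega>) (\<xi> t (na + k) \<omega>)" if "k < nb" for k
        using run[OF \<open>\<omega> \<in> space M\<close>] that by (simp add: sa2gd_run_def)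
      ultimately show ?thesis using False that(1) by (simp add: hi g_def)
    qed
    show "z (Suc t) 0 \<omega> = closest_point X (z t N \<omega>)" if "\<omega> \<in> space M" for t \<omega>
      using run[OF that] hi[of N \<omega> t] that by (simp add: lo N_def sa2gd_run_def)
    show "\<alpha> t \<ge> 0" for t using step_size c by simp
  qed (use X indep stochz outerz L' in \<open>auto simp: N_def\<close>)

  have x_star_X: "x_star \<in> X" and x_star_min: "\<And>y. y \<in> X \<Longrightarrow> ?S x_star \<le> ?S y"
    using x_star by (auto simp: is_arg_min_def not_less)
  have growth: "c / 2 * (norm (y - x_star))\<^sup>2 \<le> ?S y - ?S x_star" if "y \<in> X" for y
    by (rule weighted_sum_growth[OF X(3) x_star_X that subdifferentiable
        strong_convexity(2,4) c(2,3) l x_star_min])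
  have cont_ab: "continuous_on X fa" "continuous_on X fb"
    using lipschitz by (auto intro: lipschitz_on_continuous_on)
  have int_ab: "integrable M (\<lambda>\<omega>. fa (z t 0 \<omega>))" "integrable M (\<lambda>\<omega>. fb (z t 0 \<omega>))" if "t \<ge> 1" for t
    using integrable_outer[OF that] cont_ab by auto
  have int_S: "integrable M (\<lambda>\<omega>. ?S (z t 0 \<omega>))" if "t \<ge> 1" for t
    using int_ab[OF that] by (simp add: weighted_sum_def)
  have int_D: "integrable M (\<lambda>\<omega>. (norm (z t 0 \<omega> - x_star))\<^sup>2)" if "t \<ge> 1" for t
    by (rule integrable_outer[OF that]) (intro continuous_intros)

  define A where "A t = expectation (\<lambda>\<omega>. ?S (z t 0 \<omega>)) - ?S x_star" for t
  define D where "D t = expectation (\<lambda>\<omega>. (norm (z t 0 \<omega> - x_star))\<^sup>2)" for t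
  have "\<exists>t\<in>{1..T}. A t \<le> 6 * L'\<^sup>2 / (c * (real T + 1))"
  proof (rule weighted_descent_min[OF c(1) T])
    show "D t \<ge> 0" for t by (simp add: D_def)
    \<comment> \<open>The recursion starts at \<open>t = 1\<close>, the first iterate sure to be in
      \<open>X\<close>. With \<open>d\<close> the distance to \<open>x_star\<close>, growth and a
      bounded subgradient give \<open>c / 2 * d^2 <= L' * d\<close>, hence
      \<open>d <= 2 * L' / c\<close> almost surely.\<close>
    show "D 1 \<le> 4 * L'\<^sup>2 / c\<^sup>2"
      unfolding D_def
    proof (rule integral_le_const[OF int_D])
      \<comment> \<open>Position \<open>0\<close> selects \<open>fa\<close> and position
        \<open>na\<close> selects \<open>fb\<close>.\<close>
      have r: "0 < N" "na < N" using inner_steps by (auto simp: N_def)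
      show "AE \<omega> in M. (norm (z 1 0 \<omega> - x_star))\<^sup>2 \<le> 4 * L'\<^sup>2 / c\<^sup>2"
        using outerz[OF r(1), of 1] outerz[OF r(2), of 1] AE_space
      proof eventually_elim
        case (elim \<omega>)
        define y where "y = z 1 0 \<omega>"
        have y: "y \<in> X" using outer_mem[of 1 \<omega>] elim(3) by (simp add: y_def)
        obtain u v where u: "u \<in> subdifferential fa y" "norm u \<le> L'"
          and v: "v \<in> subdifferential fb y" "norm v \<le> L'"
          using elim inner_steps by (auto simp: f_def y_def)
        \<comment> \<open>\<open>w\<close> serves as a subgradient of the weighted sum at
          \<open>y\<close>; being a convex combination, it keeps the norm bound
          \<open>L'\<close>.\<close>
        define w where "w = lam *\<^sub>R u + (1 - lam) *\<^sub>R v"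
        have "norm w \<le> lam * norm u + (1 - lam) * norm v"
          unfolding w_def using l by (intro order_trans[OF norm_triangle_ineq]) simp
        also have "\<dots> \<le> lam * L' + (1 - lam) * L'"
          using u v l by (intro add_mono[of "lam * _" "lam * _" "(1 - lam) * _" "(1 - lam) * _"] mult_left_mono) auto
        finally have w: "norm w \<le> L'" by (simp add: algebra_simps)
        have "fa y + u \<bullet> (x_star - y) \<le> fa x_star" "fb y + v \<bullet> (x_star - y) \<le> fb x_star"
          using u v unfolding subdifferential_def by blast+
        then have "lam * (fa y + u \<bullet> (x_star - y)) + (1 - lam) * (fb y + v \<bullet> (x_star - y))
            \<le> lam * fa x_star + (1 - lam) * fb x_star"
          using l by (intro add_mono[of "lam * _" "lam * _" "(1 - lam) * _" "(1 - lam) * _"] mult_left_mono) auto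
        then have "?S y - ?S x_star \<le> w \<bullet> (y - x_star)"
          by (simp add: weighted_sum_def w_def algebra_simps inner_simps)
        also have "\<dots> \<le> norm w * norm (y - x_star)" by (rule norm_cauchy_schwarz)
        also have "\<dots> \<le> L' * norm (y - x_star)" using w by (rule mult_right_mono) simp
        finally have "c / 2 * (norm (y - x_star))\<^sup>2 \<le> L' * norm (y - x_star)"
          using growth[OF y] by linarith
        then have "norm (y - x_star) * (c * norm (y - x_star)) \<le> norm (y - x_star) * (2 * L')"
          by (simp add: power2_eq_square algebra_simps)
        then have "c * norm (y - x_star) \<le> 2 * L'"
          using L'(1) by (cases "y = x_star") auto
        then have "norm (y - x_star) \<le> 2 * L' / c"
          using c(1) by (simp add: field_simps)
        then have "(norm (y - x_star))\<^sup>2 \<le> (2 * L' / c)\<^sup>2" by (simp add: power_mono)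
        then show ?case by (simp add: y_def power_divide power_mult_distrib)
      qed
    qed simp
  next
    fix t :: nat assume t: "t \<ge> 1"
    have "c / 2 * D t = expectation (\<lambda>\<omega>. c / 2 * (norm (z t 0 \<omega> - x_star))\<^sup>2)"
      by (simp add: D_def)
    also have "\<dots> \<le> expectation (\<lambda>\<omega>. ?S (z t 0 \<omega>) - ?S x_star)"
      using int_D[OF t] int_S[OF t] growth[OF outer_mem[OF t]]
      by (intro integral_mono) auto
    also have "\<dots> = A t" using int_S[OF t] by (simp add: A_def prob_space)
    finally show "c / 2 * D t \<le> A t" .
    have "(\<Sum>r<N. expectation (\<lambda>\<omega>. f r (z t 0 \<omega>)) - f r x_star)
        = (\<Sum>r<na + nb. if r < na then expectation (\<lambda>\<omega>. fa (z t 0 \<omega>)) - fa x_star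
            else expectation (\<lambda>\<omega>. fb (z t 0 \<omega>)) - fb x_star)"
      unfolding N_def by (rule sum.cong) (auto simp: f_def)
    also have "\<dots> = real N * A t"
      unfolding sum_two_blocks using int_ab[OF t]
      by (simp add: N(2,3) A_def weighted_sum_def algebra_simps)
    finally have sum: "(\<Sum>r<N. expectation (\<lambda>\<omega>. f r (z t 0 \<omega>)) - f r x_star) = real N * A t" .
    \<comment> \<open>The step size is divided by the number of inner steps, so a whole iteration
      has the effective step \<open>2 / (c * (t + 1))\<close> that
      \<open>weighted_descent_min\<close> is tuned to.\<close>
    have \<alpha>N: "\<alpha> t * real N = 2 / (c * (real t + 1))"
      unfolding step_size N_def of_nat_add using N(1)[unfolded N_def of_nat_add]
      by (metis nonzero_mult_divide_mult_cancel_right less_irrefl times_divide_eq_left)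
    have "D (Suc t) \<le> D t - 2 * \<alpha> t * (real N * A t) + (\<alpha> t)\<^sup>2 * L'\<^sup>2 * (real N)\<^sup>2"
      using expected_descent[OF t x_star_X] unfolding sum D_def .
    also have "\<dots> = D t - 2 * (\<alpha> t * real N) * A t + (\<alpha> t * real N)\<^sup>2 * L'\<^sup>2"
      by (simp add: power_mult_distrib)
    finally show "D (Suc t) \<le> D t - 4 / (c * (real t + 1)) * A t + 4 * L'\<^sup>2 / (c\<^sup>2 * (real t + 1)\<^sup>2)"
      unfolding \<alpha>N by (simp add: power_divide power_mult_distrib)
  qed
  then obtain t where t: "t \<in> {1..T}" and le: "A t \<le> 6 * L'\<^sup>2 / (c * (real T + 1))" by blast
  have "expectation (\<lambda>\<omega>. ?S (x t \<omega>)) = expectation (\<lambda>\<omega>. ?S (z t 0 \<omega>))"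
    by (rule Bochner_Integration.integral_cong) (use run in \<open>auto simp: lo sa2gd_run_def\<close>)
  moreover have "Min ((\<lambda>t. expectation (\<lambda>\<omega>. ?S (x t \<omega>))) ` {1..T}) \<le> expectation (\<lambda>\<omega>. ?S (x t \<omega>))"
    using t by (intro Min_le) auto
  ultimately have "Min ((\<lambda>t. expectation (\<lambda>\<omega>. ?S (x t \<omega>))) ` {1..T}) - ?S x_star \<le> A t"
    by (simp add: A_def)
  also note le
  \<comment> \<open>Writing \<open>6\<close> as \<open>4 * (3 / 2)\<close> exposes the slack
    \<open>L'^2 / 2 + L * L' + c * \<Theta> * L'\<close>, which is nonnegative.\<close>
  also have "6 * L'\<^sup>2 / (c * (real T + 1)) = 4 / (c * (real T + 1)) * (3 / 2 * L'\<^sup>2)"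
    by simp
  also have "\<dots> \<le> 4 / (c * (real T + 1)) * (2 * L'\<^sup>2 + L * L' + c * \<Theta> * L')"
  proof (rule mult_left_mono)
    have "0 \<le> L * L'" "0 \<le> c * \<Theta> * L'" "0 \<le> L'\<^sup>2"
      using L_pos L' c bounded_region(1) by simp_all
    then show "3 / 2 * L'\<^sup>2 \<le> 2 * L'\<^sup>2 + L * L' + c * \<Theta> * L'" by linarith
  qed (use c in simp)
  finally show ?thesis .
qed

end
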